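(* Let $\Omega$ be a compact topological space and $\mathcal{E}$ a Banach space. A family $\{T_\omega\}_{\omega\in\Omega}$ of contractive $C_0$-semigroups on $\mathcal{E}$ is $k_{\mathrm{SOT}}$-continuous in the index set if and only if there exist a Banach space $\tilde{\mathcal{E}}$, an isometric embedding $r\in\mathcal{L}(\mathcal{E},\tilde{\mathcal{E}})$, a strongly continuous family $\{j_\omega\}_{\omega\in\Omega}\subseteq\mathcal{L}(\tilde{\mathcal{E}},\mathcal{E})$ of surjective isometries, and a strongly continuous representation $U_\Omega$ of $\mathbb{R}$ on $\tilde{\mathcal{E}}$ consisting of surjective isometries on $\tilde{\mathcal{E}}$, such that $$j_\omega\,U_\Omega(t)\,r=T_\omega(t)$$ for all $\omega\in\Omega$ and $t\in\mathbb{R}_{\ge0}$.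
   Context: $\mathcal{L}(\mathcal{E},\mathcal{F})$ denotes the bounded linear operators between Banach spaces. A family $\{j_\omega\}_{\omega\in\Omega}$ is strongly continuous if $\omega\mapsto j_\omega\xi$ is norm-continuous for each $\xi$. A representation of $\mathbb{R}$ by surjective isometries is a group homomorphism from $(\mathbb{R},+)$ into the group of surjective linear isometries. $\{T_\omega\}_{\omega\in\Omega}$ is $k_{\mathrm{SOT}}$-continuous in the index set if for every $\omega_0\in\Omega$, every compact $K\subseteq\mathbb{R}_{\ge 0}$ and every $\xi\in\mathcal{E}$ one has $\sup_{t\in K}\|(T_\omega(t)-T_{\omega_0}(t))\xi\|\to0$ as $\omega\to\omega_0$.
   Formalization: The maps j_ω are taken as surjections that are isometric modulo their kernel (quotient maps), since norm-preserving j_ω would force every T_ω(t) to be isometric, which fails for T(t)=e^{-t} on the scalars with Ω a point. *)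

theory Defs
  imports "HOL-Analysis.Analysis"
begin

text \<open>
  Scalars range over an arbitrary type of class \<^class>\<open>real_normed_field\<close>, so that real and complex
  Banach spaces are both covered. A Banach space over these scalars is a subset \<open>V\<close> of a normed real
  vector space, complete in the inherited norm, with a scalar multiplication on \<open>V\<close> extending the real one.
  The carrier \<open>V\<close> is needed because one cannot quantify existentially over types.
\<close>

locale banach_space_on =
  fixes smul :: "'k::real_normed_field \<Rightarrow> 'v::real_normed_vector \<Rightarrow> 'v"
    and V :: "'v set"
  assumes zero_closed: "0 \<in> V"
    and add_closed: "\<lbrakk>x \<in> V; y \<in> V\<rbrakk> \<Longrightarrow> x + y \<in> V"
    and scale_closed: "x \<in> V \<Longrightarrow> smul c x \<in> V"
    and scale_add_right: "\<lbrakk>x \<in> V; y \<in> V\<rbrakk> \<Longrightarrow> smul c (x + y) = smul c x + smul c y"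
    and scale_add_left: "x \<in> V \<Longrightarrow> smul (c + d) x = smul c x + smul d x"
    and scale_assoc: "x \<in> V \<Longrightarrow> smul c (smul d x) = smul (c * d) x"
    and scale_of_real: "x \<in> V \<Longrightarrow> smul (of_real a) x = a *\<^sub>R x"
    and norm_scale: "x \<in> V \<Longrightarrow> norm (smul c x) = norm c * norm x"
    and complete_carrier: "complete V"

definition bounded_operator_on ::
    "('k \<Rightarrow> 'v \<Rightarrow> 'v) \<Rightarrow> 'v::real_normed_vector set \<Rightarrow>
     ('k \<Rightarrow> 'u \<Rightarrow> 'u) \<Rightarrow> 'u::real_normed_vector set \<Rightarrow> ('v \<Rightarrow> 'u) \<Rightarrow> bool" where
  "bounded_operator_on scaleV V scaleW W f \<longleftrightarrow>
     (\<forall>x\<in>V. f x \<in> W) \<and>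
     (\<forall>x\<in>V. \<forall>y\<in>V. f (x + y) = f x + f y) \<and>
     (\<forall>c. \<forall>x\<in>V. f (scaleV c x) = scaleW c (f x)) \<and>
     (\<exists>B. \<forall>x\<in>V. norm (f x) \<le> B * norm x)"

definition isometric_on :: "'v::real_normed_vector set \<Rightarrow> ('v \<Rightarrow> 'u::real_normed_vector) \<Rightarrow> bool" where
  "isometric_on V f \<longleftrightarrow> (\<forall>x\<in>V. norm (f x) = norm x)"

text \<open>
  The maps \<open>j \<omega>\<close> below are surjective isometries in the sense of quotient maps: \<open>j \<omega>\<close> is onto and induces
  an isometry from the quotient by its kernel, the infimum being the quotient norm of the fibre
  over \<open>y\<close>. Norm preservation on the whole of the large space cannot be meant: together with the other
  conditions on a dilation it would force every \<open>T \<omega> t\<close> to be isometric.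
\<close>

definition surjective_isometry_mod_kernel ::
    "'v::real_normed_vector set \<Rightarrow> 'u::real_normed_vector set \<Rightarrow> ('v \<Rightarrow> 'u) \<Rightarrow> bool" where
  "surjective_isometry_mod_kernel V W f \<longleftrightarrow>
     f ` V = W \<and> (\<forall>y\<in>W. (INF x\<in>{x\<in>V. f x = y}. norm x) = norm y)"

text \<open>One-parameter semigroups are functions on all reals, of which only the values at \<open>t \<ge> 0\<close> matter.\<close>

definition contractive_C0_semigroup ::
    "('k \<Rightarrow> 'e \<Rightarrow> 'e) \<Rightarrow> (real \<Rightarrow> 'e \<Rightarrow> 'e::real_normed_vector) \<Rightarrow> bool" where
  "contractive_C0_semigroup smul T \<longleftrightarrow>
     (\<forall>t\<ge>0. bounded_operator_on smul UNIV smul UNIV (T t)) \<and>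
     (\<forall>x. T 0 x = x) \<and>
     (\<forall>s\<ge>0. \<forall>t\<ge>0. \<forall>x. T (s + t) x = T s (T t x)) \<and>
     (\<forall>x. continuous_on {0..} (\<lambda>t. T t x)) \<and>
     (\<forall>t\<ge>0. \<forall>x. norm (T t x) \<le> norm x)"

definition isometric_representation_on ::
    "('k \<Rightarrow> 'v \<Rightarrow> 'v) \<Rightarrow> 'v::real_normed_vector set \<Rightarrow> (real \<Rightarrow> 'v \<Rightarrow> 'v) \<Rightarrow> bool" where
  "isometric_representation_on smul V U \<longleftrightarrow>
     (\<forall>t. bounded_operator_on smul V smul V (U t) \<and> isometric_on V (U t) \<and> U t ` V = V) \<and>
     (\<forall>x\<in>V. U 0 x = x) \<and>
     (\<forall>s t. \<forall>x\<in>V. U (s + t) x = U s (U t x))"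

text \<open>\<open>K = {}\<close> is excluded since the supremum of the empty set of reals is unspecified.\<close>

definition kSOT_continuous_in_index ::
    "('w::topological_space \<Rightarrow> real \<Rightarrow> 'e \<Rightarrow> 'e::real_normed_vector) \<Rightarrow> bool" where
  "kSOT_continuous_in_index T \<longleftrightarrow>
     (\<forall>\<omega>\<^sub>0 K \<xi>. compact K \<and> K \<subseteq> {0..} \<and> K \<noteq> {} \<longrightarrow>
        ((\<lambda>\<omega>. SUP t\<in>K. norm (T \<omega> t \<xi> - T \<omega>\<^sub>0 t \<xi>)) \<longlongrightarrow> 0) (at \<omega>\<^sub>0))"

definition simultaneous_dilation ::
    "('k::real_normed_field \<Rightarrow> 'e \<Rightarrow> 'e) \<Rightarrow>
     ('w::topological_space \<Rightarrow> real \<Rightarrow> 'e \<Rightarrow> 'e::real_normed_vector) \<Rightarrow>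
     ('k \<Rightarrow> 'v \<Rightarrow> 'v) \<Rightarrow> 'v::real_normed_vector set \<Rightarrow>
     ('e \<Rightarrow> 'v) \<Rightarrow> ('w \<Rightarrow> 'v \<Rightarrow> 'e) \<Rightarrow> (real \<Rightarrow> 'v \<Rightarrow> 'v) \<Rightarrow> bool" where
  "simultaneous_dilation scaleE T scaleV V r j U \<longleftrightarrow>
     banach_space_on scaleV V \<and>
     bounded_operator_on scaleE UNIV scaleV V r \<and> isometric_on UNIV r \<and>
     (\<forall>\<omega>. bounded_operator_on scaleV V scaleE UNIV (j \<omega>) \<and>
          surjective_isometry_mod_kernel V UNIV (j \<omega>)) \<and>
     (\<forall>x\<in>V. continuous_on UNIV (\<lambda>\<omega>. j \<omega> x)) \<and>
     isometric_representation_on scaleV V U \<and>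
     (\<forall>x\<in>V. continuous_on UNIV (\<lambda>t. U t x)) \<and>
     (\<forall>\<omega>. \<forall>t\<ge>0. \<forall>\<xi>. j \<omega> (U t (r \<xi>)) = T \<omega> t \<xi>)"

end

theory Submission
  imports Defs
begin

text \<open>
  For contractive \<open>C\<^sub>0\<close>-semigroups, continuity in the index uniformly on compact time sets says
  the same as joint continuity of \<open>(t, \<omega>) \<mapsto> T \<omega> t x\<close> for every \<open>x\<close>
  (\<open>kSOT_continuous_in_index_iff_jointly_continuous\<close>); both directions go through joint continuity.

  Given a dilation, the maps \<open>j \<omega>\<close> are contractions, because a quotient norm is at most the
  norm of any representative. Hence \<open>(t, \<omega>) \<mapsto> j \<omega> (U t (r x))\<close> is jointly continuous:
  moving \<open>t\<close> costs at most the displacement of \<open>U t (r x)\<close>, uniformly in \<open>\<omega>\<close>, and moving \<open>\<omega>\<close>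
  is harmless by strong continuity.

  Conversely, the dilation is the translation flow on bounded continuous functions
  \<open>f : \<real> \<times> \<Omega> \<rightarrow> E\<close>, cut down to the closed subspace of those \<open>f\<close> whose translates depend
  continuously on the time in supremum norm. The map \<open>j \<omega>\<close> evaluates at \<open>(0, \<omega>)\<close>; it is a quotient
  map because constant functions are norm-minimal preimages. The embedding \<open>r\<close> sends \<open>x\<close> to its
  orbit function \<open>(s, \<omega>) \<mapsto> T \<omega> (max s 0) x\<close>, which stays at \<open>x\<close> for negative times.
  Evaluating the translate of the orbit by \<open>t \<ge> 0\<close> at \<open>(0, \<omega>)\<close> gives \<open>T \<omega> t x\<close>, and contractivity
  makes \<open>r\<close> isometric. The two points needing an argument are that the orbit function is
  continuous, which is the joint continuity, and that translation acts on it norm-continuously.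
  For the latter, a time shift by \<open>h\<close> moves the orbit function by at most
  the supremum of \<open>\<parallel>T \<omega> u x - x\<parallel>\<close> over all \<open>\<omega>\<close> and \<open>0 \<le> u \<le> \<bar>h\<bar>\<close>
  (\<open>contractive_C0_semigroup_dist_le\<close>), and compactness of \<open>\<Omega>\<close> makes this tend to \<open>0\<close> with \<open>h\<close>.
\<close>

section \<open>Contractive semigroups and joint continuity\<close>

lemma bounded_operator_on_UNIV_diff:
  assumes "bounded_operator_on smul UNIV smul' UNIV f"
  shows "f (x - y) = f x - f y"
proof -
  have "f ((x - y) + y) = f (x - y) + f y"
    using assms unfolding bounded_operator_on_def by blast
  then show ?thesis by simp
qed

text \<open>
  The later of the two times is reached from the earlier one by the semigroup law, and the
  contraction \<open>T (min a b)\<close> can only shrink the displacement over the elapsed time.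
\<close>

lemma contractive_C0_semigroup_dist_le:
  assumes T: "contractive_C0_semigroup smul T" and "a \<ge> 0" "b \<ge> 0"
  shows "dist (T a x) (T b x) \<le> dist (T \<bar>a - b\<bar> x) x"
proof -
  have ordered: "dist (T t x) (T s x) \<le> dist (T (t - s) x) x" if "0 \<le> s" "s \<le> t" for s t
  proof -
    have "T (s + u) x = T s (T u x)" if "u \<ge> 0" for u
      using T \<open>0 \<le> s\<close> that unfolding contractive_C0_semigroup_def by blast
    from this[of "t - s"] have "T t x = T s (T (t - s) x)"
      using that by simp
    moreover have "T s (T (t - s) x - x) = T s (T (t - s) x) - T s x"
      using T that unfolding contractive_C0_semigroup_def
      by (intro bounded_operator_on_UNIV_diff) auto
    moreover have "norm (T s (T (t - s) x - x)) \<le> norm (T (t - s) x - x)"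
      using T that unfolding contractive_C0_semigroup_def by simp
    ultimately show ?thesis by (simp add: dist_norm)
  qed
  show ?thesis
    using ordered[of a b] ordered[of b a] assms(2,3)
    by (cases "a \<le> b") (auto simp: dist_commute abs_if)
qed

text \<open>
  Uniformity on compact time sets and continuity of each orbit combine to joint continuity, since
  all times near \<open>t\<^sub>0\<close> lie in one compact interval. Conversely, a jointly continuous function
  is continuous in one variable uniformly on compact sets of the other.
\<close>

lemma kSOT_continuous_in_index_iff_jointly_continuous:
  fixes T :: "'w::topological_space \<Rightarrow> real \<Rightarrow> 'e \<Rightarrow> 'e::real_normed_vector"
  assumes T: "\<And>\<omega>. contractive_C0_semigroup smul (T \<omega>)"
  shows "kSOT_continuous_in_index T \<longleftrightarrow>
    (\<forall>x. continuous_on ({0..} \<times> UNIV) (\<lambda>(t, \<omega>). T \<omega> t x))"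
proof
  assume k: "kSOT_continuous_in_index T"
  show "\<forall>x. continuous_on ({0..} \<times> UNIV) (\<lambda>(t, \<omega>). T \<omega> t x)"
  proof
    fix x
    show "continuous_on ({0..} \<times> UNIV) (\<lambda>(t, \<omega>). T \<omega> t x)"
      unfolding continuous_on_def
    proof (clarify intro!: tendstoI)
      fix t\<^sub>0 :: real and \<omega>\<^sub>0 :: 'w and e :: real
      assume t0: "t\<^sub>0 \<ge> 0" and e: "e > 0"
      let ?K = "{0..t\<^sub>0 + 1}"
      have "((\<lambda>\<omega>. SUP t\<in>?K. norm (T \<omega> t x - T \<omega>\<^sub>0 t x)) \<longlongrightarrow> 0) (at \<omega>\<^sub>0)"
        using k t0 unfolding kSOT_continuous_in_index_def by simp
      then have "\<forall>\<^sub>F \<omega> in at \<omega>\<^sub>0. (SUP t\<in>?K. norm (T \<omega> t x - T \<omega>\<^sub>0 t x)) < e / 2"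
        by (rule order_tendstoD) (use e in simp)
      then obtain N where N: "open N" "\<omega>\<^sub>0 \<in> N"
        "\<And>\<omega>. \<omega> \<in> N \<Longrightarrow> \<omega> \<noteq> \<omega>\<^sub>0 \<Longrightarrow> (SUP t\<in>?K. norm (T \<omega> t x - T \<omega>\<^sub>0 t x)) < e / 2"
        unfolding eventually_at_topological by auto
      have index: "dist (T \<omega> t x) (T \<omega>\<^sub>0 t x) < e / 2" if "\<omega> \<in> N" "t \<in> ?K" for \<omega> t
      proof (cases "\<omega> = \<omega>\<^sub>0")
        case False
        have "norm (T \<omega> t x - T \<omega>\<^sub>0 t x) \<le> norm x + norm x" if "t \<in> ?K" for t
        proof (rule order_trans[OF norm_triangle_ineq4], rule add_mono)
          show "norm (T \<omega> t x) \<le> norm x" "norm (T \<omega>\<^sub>0 t x) \<le> norm x"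
            using T that unfolding contractive_C0_semigroup_def by auto
        qed
        then have "bdd_above ((\<lambda>t. norm (T \<omega> t x - T \<omega>\<^sub>0 t x)) ` ?K)"
          by (intro bdd_aboveI2)
        from cSUP_upper[OF that(2) this] N(3)[OF that(1) False] show ?thesis
          by (simp add: dist_norm)
      qed (use e in simp)
      have "((\<lambda>t. T \<omega>\<^sub>0 t x) \<longlongrightarrow> T \<omega>\<^sub>0 t\<^sub>0 x) (at t\<^sub>0 within {0..})"
        using T[of \<omega>\<^sub>0] t0 unfolding contractive_C0_semigroup_def continuous_on_def by simp
      from tendstoD[OF this, of "e / 2"] e
      obtain A where A: "open A" "t\<^sub>0 \<in> A"
        "\<And>t. t \<in> A \<Longrightarrow> t \<noteq> t\<^sub>0 \<Longrightarrow> t \<ge> 0 \<Longrightarrow> dist (T \<omega>\<^sub>0 t x) (T \<omega>\<^sub>0 t\<^sub>0 x) < e / 2"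
        unfolding eventually_at_topological by auto
      have time: "dist (T \<omega>\<^sub>0 t x) (T \<omega>\<^sub>0 t\<^sub>0 x) < e / 2" if "t \<in> A" "t \<ge> 0" for t
        using A(3) that e by (cases "t = t\<^sub>0") auto
      have close: "dist (T \<omega> t x) (T \<omega>\<^sub>0 t\<^sub>0 x) < e"
        if "t \<in> A" "t < t\<^sub>0 + 1" "t \<ge> 0" "\<omega> \<in> N" for t \<omega>
        using index[of \<omega> t] time[of t] that
          dist_triangle[of "T \<omega> t x" "T \<omega>\<^sub>0 t\<^sub>0 x" "T \<omega>\<^sub>0 t x"] by auto
      have "open ((A \<inter> {..<t\<^sub>0 + 1}) \<times> N)" "(t\<^sub>0, \<omega>\<^sub>0) \<in> (A \<inter> {..<t\<^sub>0 + 1}) \<times> N"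
        using A N by (auto intro!: open_Times open_Int)
      then show "\<forall>\<^sub>F p in at (t\<^sub>0, \<omega>\<^sub>0) within {0..} \<times> UNIV.
          dist (case p of (t, \<omega>) \<Rightarrow> T \<omega> t x) (T \<omega>\<^sub>0 t\<^sub>0 x) < e"
        unfolding eventually_at_topological
        by (intro exI[of _ "(A \<inter> {..<t\<^sub>0 + 1}) \<times> N"]) (auto intro: close)
    qed
  qed
next
  assume joint: "\<forall>x. continuous_on ({0..} \<times> UNIV) (\<lambda>(t, \<omega>). T \<omega> t x)"
  show "kSOT_continuous_in_index T"
    unfolding kSOT_continuous_in_index_def
  proof (clarify intro!: tendstoI)
    fix \<omega>\<^sub>0 and K :: "real set" and x and e :: real
    assume K: "compact K" "K \<subseteq> {0..}" "K \<noteq> {}" and e: "e > 0"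
    have "continuous_on (UNIV \<times> K) ((\<lambda>(t, \<omega>). T \<omega> t x) \<circ> prod.swap)"
      by (intro continuous_on_compose continuous_on_subset[OF joint[rule_format]] continuous_on_swap)
        (use K in auto)
    then obtain N where N: "\<omega>\<^sub>0 \<in> N" "open N"
      "\<forall>\<omega>\<in>N \<inter> UNIV. \<forall>t\<in>K. dist (((\<lambda>(t, \<omega>). T \<omega> t x) \<circ> prod.swap) (\<omega>, t))
         (((\<lambda>(t, \<omega>). T \<omega> t x) \<circ> prod.swap) (\<omega>\<^sub>0, t)) \<le> e / 2"
      by (rule continuous_on_prod_compactE[OF _ K(1), of _ _ \<omega>\<^sub>0 "e / 2"]) (use e in auto)
    have "dist (SUP t\<in>K. norm (T \<omega> t x - T \<omega>\<^sub>0 t x)) 0 < e" if "\<omega> \<in> N" for \<omega>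
    proof -
      have bound: "norm (T \<omega> t x - T \<omega>\<^sub>0 t x) \<le> e / 2" if "t \<in> K" for t
        using N(3) \<open>\<omega> \<in> N\<close> that by (simp add: dist_norm)
      then have bdd: "bdd_above ((\<lambda>t. norm (T \<omega> t x - T \<omega>\<^sub>0 t x)) ` K)"
        by (intro bdd_aboveI2)
      obtain t where "t \<in> K" using K by blast
      from cSUP_upper[OF this bdd] have "0 \<le> (SUP t\<in>K. norm (T \<omega> t x - T \<omega>\<^sub>0 t x))"
        by (rule order_trans[OF norm_ge_zero])
      moreover have "(SUP t\<in>K. norm (T \<omega> t x - T \<omega>\<^sub>0 t x)) \<le> e / 2"
        using bound K by (intro cSUP_least) auto
      ultimately show ?thesis using e by simp
    qed
    then show "\<forall>\<^sub>F \<omega> in at \<omega>\<^sub>0. dist (SUP t\<in>K. norm (T \<omega> t x - T \<omega>\<^sub>0 t x)) 0 < e"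
      unfolding eventually_at_topological using N by blast
  qed
qed

section \<open>Dilations force continuity in the index\<close>

lemma surjective_isometry_mod_kernel_norm_le:
  assumes "surjective_isometry_mod_kernel V UNIV f" "x \<in> V"
  shows "norm (f x) \<le> norm x"
proof -
  have "(INF v\<in>{v\<in>V. f v = f x}. norm v) = norm (f x)"
    using assms unfolding surjective_isometry_mod_kernel_def by simp
  moreover have "(INF v\<in>{v\<in>V. f v = f x}. norm v) \<le> norm x"
    by (rule cINF_lower) (use assms(2) in \<open>auto intro!: bdd_belowI2[of _ 0]\<close>)
  ultimately show ?thesis by simp
qed

lemma banach_space_on_diff_closed:
  assumes "banach_space_on smul V" "x \<in> V" "y \<in> V"
  shows "x - y \<in> V"
proof -
  interpret banach_space_on smul V by fact
  have "(-1) *\<^sub>R y \<in> V"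
    using scale_closed[OF assms(3), of "of_real (-1)"] scale_of_real[OF assms(3), of "-1"] by simp
  from add_closed[OF assms(2) this] show ?thesis by simp
qed

lemma kSOT_continuous_in_index_if_dilation:
  fixes T :: "'w::topological_space \<Rightarrow> real \<Rightarrow> 'e \<Rightarrow> 'e::real_normed_vector"
    and V :: "'v::real_normed_vector set"
  assumes T: "\<And>\<omega>. contractive_C0_semigroup scaleE (T \<omega>)"
    and dilation: "simultaneous_dilation scaleE T scaleV V r j U"
  shows "kSOT_continuous_in_index T"
  unfolding kSOT_continuous_in_index_iff_jointly_continuous[where T = T, OF T]
proof
  fix x
  have banach: "banach_space_on scaleV V"
    and r: "r x \<in> V"
    and j: "\<And>\<omega>. bounded_operator_on scaleV V scaleE UNIV (j \<omega>)"
      "\<And>\<omega>. surjective_isometry_mod_kernel V UNIV (j \<omega>)"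
    and jcont: "\<And>v. v \<in> V \<Longrightarrow> continuous_on UNIV (\<lambda>\<omega>. j \<omega> v)"
    and UV: "\<And>t v. v \<in> V \<Longrightarrow> U t v \<in> V"
    and Ucont: "\<And>v. v \<in> V \<Longrightarrow> continuous_on UNIV (\<lambda>t. U t v)"
    and dil: "\<And>\<omega> t. t \<ge> 0 \<Longrightarrow> T \<omega> t x = j \<omega> (U t (r x))"
    using dilation
    unfolding simultaneous_dilation_def isometric_representation_on_def bounded_operator_on_def
    by auto
  have j_dist: "dist (j \<omega> u) (j \<omega> v) \<le> dist u v" if "u \<in> V" "v \<in> V" for \<omega> u v
  proof -
    have mem: "u - v \<in> V" using banach_space_on_diff_closed[OF banach] that .
    have "j \<omega> ((u - v) + v) = j \<omega> (u - v) + j \<omega> v"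
      using j(1)[of \<omega>] mem that unfolding bounded_operator_on_def by blast
    then have "dist (j \<omega> u) (j \<omega> v) = norm (j \<omega> (u - v))" by (simp add: dist_norm)
    also have "\<dots> \<le> dist u v"
      using surjective_isometry_mod_kernel_norm_le[OF j(2) mem] by (simp add: dist_norm)
    finally show ?thesis .
  qed
  have "continuous_on UNIV (\<lambda>(t, \<omega>). j \<omega> (U t (r x)))"
    unfolding continuous_on_def
  proof clarify
    fix t\<^sub>0 :: real and \<omega>\<^sub>0 :: 'w
    let ?F = "at (t\<^sub>0, \<omega>\<^sub>0)"
    have "continuous_on UNIV (\<lambda>p. U (fst p) (r x))" "continuous_on UNIV (\<lambda>p. j (snd p) (U t\<^sub>0 (r x)))"
      by (rule continuous_on_compose2[OF Ucont[OF r]] continuous_on_compose2[OF jcont[OF UV[OF r]]],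
          auto intro: continuous_intros)+
    then have "((\<lambda>p. dist (U (fst p) (r x)) (U t\<^sub>0 (r x))) \<longlongrightarrow> 0) ?F"
      "((\<lambda>p. dist (j (snd p) (U t\<^sub>0 (r x))) (j \<omega>\<^sub>0 (U t\<^sub>0 (r x)))) \<longlongrightarrow> 0) ?F"
      unfolding continuous_on_def by (auto intro!: iffD1[OF tendsto_dist_iff] dest!: spec)
    from tendsto_add[OF this]
    have lim: "((\<lambda>p. dist (U (fst p) (r x)) (U t\<^sub>0 (r x)) +
        dist (j (snd p) (U t\<^sub>0 (r x))) (j \<omega>\<^sub>0 (U t\<^sub>0 (r x)))) \<longlongrightarrow> 0) ?F" by simp
    have "dist (j \<omega> (U t (r x))) (j \<omega>\<^sub>0 (U t\<^sub>0 (r x))) \<le> dist (U t (r x)) (U t\<^sub>0 (r x)) +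
        dist (j \<omega> (U t\<^sub>0 (r x))) (j \<omega>\<^sub>0 (U t\<^sub>0 (r x)))" for t \<omega>
      using j_dist[OF UV[OF r] UV[OF r], of \<omega> t t\<^sub>0]
        dist_triangle[of "j \<omega> (U t (r x))" "j \<omega>\<^sub>0 (U t\<^sub>0 (r x))" "j \<omega> (U t\<^sub>0 (r x))"] by linarith
    then have "((\<lambda>p. dist (case p of (t, \<omega>) \<Rightarrow> j \<omega> (U t (r x))) (j \<omega>\<^sub>0 (U t\<^sub>0 (r x)))) \<longlongrightarrow> 0) ?F"
      by (intro tendsto_sandwich[OF _ _ tendsto_const lim])
        (auto intro!: always_eventually simp: split_beta)
    then show "((\<lambda>(t, \<omega>). j \<omega> (U t (r x))) \<longlongrightarrow> j \<omega>\<^sub>0 (U t\<^sub>0 (r x))) ?F"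
      by (rule iffD2[OF tendsto_dist_iff])
  qed
  then have "continuous_on ({0..} \<times> UNIV) (\<lambda>(t, \<omega>). j \<omega> (U t (r x)))"
    by (rule continuous_on_subset) simp
  then show "continuous_on ({0..} \<times> UNIV) (\<lambda>(t, \<omega>). T \<omega> t x)"
    by (rule continuous_on_eq) (auto simp: dil)
qed

section \<open>The translation flow on bounded continuous functions\<close>

text \<open>
  A uniformly Cauchy sequence of bounded continuous functions converges uniformly, and uniform
  limits keep continuity and boundedness. The domain is an arbitrary topological space because it
  will be \<open>\<real> \<times> \<Omega>\<close>.
\<close>

lemma complete_UNIV_bcontfun:
  "complete (UNIV :: ('a::topological_space \<Rightarrow>\<^sub>C 'b::complete_space) set)"
  unfolding complete_def
proof clarify
  fix f :: "nat \<Rightarrow> 'a \<Rightarrow>\<^sub>C 'b"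
  assume "Cauchy f"
  then have "uniformly_Cauchy_on UNIV (\<lambda>n. apply_bcontfun (f n))"
    unfolding Cauchy_def uniformly_Cauchy_on_def by (meson dist_fun_lt_imp_dist_val_lt)
  then obtain g where "uniform_limit UNIV (\<lambda>n. apply_bcontfun (f n)) g sequentially"
    using Cauchy_uniformly_convergent uniformly_convergent_on_def by blast
  from uniform_limit_bcontfunE[OF this sequentially_bot]
  show "\<exists>l\<in>UNIV. f \<longlonglongrightarrow> l" by (metis UNIV_I)
qed

definition translate :: "real \<Rightarrow> ((real \<times> 'w::topological_space) \<Rightarrow>\<^sub>C 'e::metric_space) \<Rightarrow> ((real \<times> 'w) \<Rightarrow>\<^sub>C 'e)"
  where "translate t f = Bcontfun (\<lambda>(s, \<omega>). f (s + t, \<omega>))"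

lemma apply_translate [simp]: "apply_bcontfun (translate t f) (s, \<omega>) = f (s + t, \<omega>)"
proof -
  have "continuous_on UNIV (\<lambda>p. f (fst p + t, snd p))"
    by (rule continuous_on_compose2[OF continuous_on_apply_bcontfun[of UNIV f]])
      (auto intro!: continuous_intros)
  moreover have "bounded (range (\<lambda>p. f (fst p + t, snd p)))"
    by (rule bounded_subset[OF bounded_apply_bcontfun[of f]]) auto
  ultimately have "(\<lambda>(s, \<omega>). f (s + t, \<omega>)) \<in> bcontfun"
    by (simp add: bcontfun_def split_beta)
  then show ?thesis by (simp add: translate_def Bcontfun_inverse)
qed

lemma translate_0 [simp]: "translate 0 f = f"
  by (rule bcontfun_eqI) auto

lemma translate_translate: "translate s (translate t f) = translate (s + t) f"
  by (rule bcontfun_eqI) (auto simp: algebra_simps)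

lemma translate_add: "translate t (f + g) = translate t f + translate t g"
  by (rule bcontfun_eqI) auto

lemma dist_translate [simp]: "dist (translate t f) (translate t g) = dist f g"
proof (rule antisym)
  have le: "dist (translate t f) (translate t g) \<le> dist f g" for t and f g :: "(real \<times> 'a) \<Rightarrow>\<^sub>C 'b"
    by (rule dist_bound) (auto intro: dist_bounded)
  then show "dist (translate t f) (translate t g) \<le> dist f g" .
  \<comment> \<open>the reverse inequality is the same bound for the inverse translation\<close>
  from le[of "- t" "translate t f" "translate t g"]
  show "dist f g \<le> dist (translate t f) (translate t g)" by (simp add: translate_translate)
qed

lemma norm_translate [simp]: "norm (translate t f) = norm f"
proof -
  have "translate t (0 :: (real \<times> 'a) \<Rightarrow>\<^sub>C 'b) = 0" by (rule bcontfun_eqI) auto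
  then show ?thesis using dist_translate[of t f 0] by (simp add: dist_norm)
qed

text \<open>
  On all bounded continuous functions translation need not be strongly continuous; this is the
  largest subspace on which it is.
\<close>

definition translation_continuous :: "((real \<times> 'w::topological_space) \<Rightarrow>\<^sub>C 'e::metric_space) set"
  where "translation_continuous = {f. continuous_on UNIV (\<lambda>t. translate t f)}"

lemma translate_mem_translation_continuous:
  assumes "f \<in> translation_continuous"
  shows "translate t f \<in> translation_continuous"
  using assms unfolding translation_continuous_def translate_translate mem_Collect_eq
  by (rule continuous_on_compose2) (auto intro!: continuous_intros)

text \<open>
  Translations are isometric, so convergence of functions gives convergence of their
  translates uniformly in the time.
\<close>

lemma closed_translation_continuous: "closed translation_continuous"
  unfolding closed_sequential_limits
proof clarify
  fix f :: "nat \<Rightarrow> (real \<times> 'a) \<Rightarrow>\<^sub>C 'b" and l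
  assume f: "\<forall>n. f n \<in> translation_continuous" and lim: "f \<longlonglongrightarrow> l"
  have "uniform_limit UNIV (\<lambda>n t. translate t (f n)) (\<lambda>t. translate t l) sequentially"
    using tendstoD[OF lim] by (intro uniform_limitI) simp
  then have "continuous_on UNIV (\<lambda>t. translate t l)"
    by (rule uniform_limit_theorem[rotated])
      (use f in \<open>auto simp: translation_continuous_def\<close>)
  then show "l \<in> translation_continuous" by (simp add: translation_continuous_def)
qed

text \<open>Hence scaling is continuous, and scaling a continuous function pointwise keeps it continuous.\<close>

lemma banach_space_on_bounded_linear:
  assumes "banach_space_on smul UNIV"
  shows "bounded_linear (smul c)"
proof -
  interpret banach_space_on smul UNIV by fact
  show ?thesis
  proof (rule bounded_linear_intro[where K = "norm c"])
    fix a x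
    \<comment> \<open>a real factor is a scalar factor, and scalars commute\<close>
    have "smul c (smul (of_real a) x) = smul (of_real a) (smul c x)"
      by (simp add: scale_assoc mult.commute)
    then show "smul c (a *\<^sub>R x) = a *\<^sub>R smul c x" by (simp add: scale_of_real)
  qed (simp_all add: scale_add_right norm_scale mult.commute)
qed

definition pointwise_scale ::
    "('k \<Rightarrow> 'e \<Rightarrow> 'e) \<Rightarrow> 'k \<Rightarrow> ('a::topological_space \<Rightarrow>\<^sub>C 'e::real_normed_vector) \<Rightarrow> ('a \<Rightarrow>\<^sub>C 'e)"
  where "pointwise_scale smul c f = Bcontfun (\<lambda>x. smul c (f x))"

lemma apply_pointwise_scale:
  assumes "banach_space_on smul UNIV"
  shows "apply_bcontfun (pointwise_scale smul c f) x = smul c (f x)"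
proof -
  interpret banach_space_on smul UNIV by fact
  have "continuous_on UNIV (\<lambda>x. smul c (f x))"
    by (intro bounded_linear.continuous_on[OF banach_space_on_bounded_linear[OF assms]]) simp
  moreover have "norm (smul c (f x)) \<le> norm c * norm f" for x
    by (simp add: norm_scale mult_left_mono norm_bounded)
  ultimately have "(\<lambda>x. smul c (f x)) \<in> bcontfun" by (rule bcontfun_normI)
  then show ?thesis by (simp add: pointwise_scale_def Bcontfun_inverse)
qed

lemma norm_pointwise_scale:
  fixes smul :: "'k::real_normed_field \<Rightarrow> 'e::real_normed_vector \<Rightarrow> 'e"
    and f :: "'a::topological_space \<Rightarrow>\<^sub>C 'e"
  assumes "banach_space_on smul UNIV"
  shows "norm (pointwise_scale smul c f) = norm c * norm f"
proof -
  interpret banach_space_on smul UNIV by fact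
  have le: "norm (pointwise_scale smul c f) \<le> norm c * norm f" for c f
    by (rule norm_bound)
      (simp add: apply_pointwise_scale[OF assms] norm_scale mult_left_mono norm_bounded)
  show ?thesis
  proof (cases "c = 0")
    case True
    then show ?thesis using le[of 0 f] by simp
  next
    case False
    \<comment> \<open>dividing by \<open>c\<close> turns the upper bound into the lower one\<close>
    have "smul 1 v = v" for v using scale_of_real[of v 1] by simp
    then have "pointwise_scale smul (inverse c) (pointwise_scale smul c f) = f"
      using False by (intro bcontfun_eqI) (simp add: apply_pointwise_scale[OF assms] scale_assoc)
    then have "norm f \<le> norm (inverse c) * norm (pointwise_scale smul c f)"
      using le[of "inverse c" "pointwise_scale smul c f"] by simp
    then have "norm f \<le> norm (pointwise_scale smul c f) / norm c"
      by (simp add: norm_inverse divide_inverse mult.commute)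
    then have "norm c * norm f \<le> norm (pointwise_scale smul c f)"
      using False by (simp add: pos_le_divide_eq mult.commute)
    with le[of c f] show ?thesis by simp
  qed
qed

lemma translate_pointwise_scale:
  assumes "banach_space_on smul UNIV"
  shows "translate t (pointwise_scale smul c f) = pointwise_scale smul c (translate t f)"
  by (rule bcontfun_eqI) (auto simp: apply_pointwise_scale[OF assms])

lemma banach_space_on_translation_continuous:
  fixes smul :: "'k::real_normed_field \<Rightarrow> 'e::banach \<Rightarrow> 'e"
  assumes "banach_space_on smul UNIV"
  shows "banach_space_on (pointwise_scale smul)
    (translation_continuous :: ((real \<times> 'w::topological_space) \<Rightarrow>\<^sub>C 'e) set)"
    (is "banach_space_on _ ?V")
proof -
  interpret E: banach_space_on smul UNIV by fact
  note apply_scale = apply_pointwise_scale[OF assms]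
  have add: "pointwise_scale smul c (f + g) = pointwise_scale smul c f + pointwise_scale smul c g"
    for c and f g :: "(real \<times> 'w) \<Rightarrow>\<^sub>C 'e"
    by (rule bcontfun_eqI) (simp add: apply_scale E.scale_add_right)
  have real: "pointwise_scale smul (of_real a) f = a *\<^sub>R f" for a and f :: "(real \<times> 'w) \<Rightarrow>\<^sub>C 'e"
    by (rule bcontfun_eqI) (simp add: apply_scale E.scale_of_real)
  have assoc: "pointwise_scale smul c (pointwise_scale smul d f) = pointwise_scale smul (c * d) f"
    for c d and f :: "(real \<times> 'w) \<Rightarrow>\<^sub>C 'e"
    by (rule bcontfun_eqI) (simp add: apply_scale E.scale_assoc)
  have linear: "bounded_linear (pointwise_scale smul c :: ((real \<times> 'w) \<Rightarrow>\<^sub>C 'e) \<Rightarrow> _)" for c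
  proof (rule bounded_linear_intro[where K = "norm c"])
    fix a and f :: "(real \<times> 'w) \<Rightarrow>\<^sub>C 'e"
    show "pointwise_scale smul c (a *\<^sub>R f) = a *\<^sub>R pointwise_scale smul c f"
      unfolding real[symmetric] assoc by (simp add: mult.commute)
  qed (simp_all add: add norm_pointwise_scale[OF assms] mult.commute)
  show ?thesis
  proof
    have "translate t (0 :: (real \<times> 'w) \<Rightarrow>\<^sub>C 'e) = 0" for t by (rule bcontfun_eqI) auto
    then show "0 \<in> ?V" by (simp add: translation_continuous_def)
    show "f + g \<in> ?V" if "f \<in> ?V" "g \<in> ?V" for f g
      using that by (auto simp: translation_continuous_def translate_add intro: continuous_on_add)
    show "pointwise_scale smul c f \<in> ?V" if "f \<in> ?V" for c f
      using that bounded_linear.continuous_on[OF linear]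
      by (auto simp: translation_continuous_def translate_pointwise_scale[OF assms])
    show "pointwise_scale smul (c + d) f = pointwise_scale smul c f + pointwise_scale smul d f"
      for c d and f :: "(real \<times> 'w) \<Rightarrow>\<^sub>C 'e"
      by (rule bcontfun_eqI) (simp add: apply_scale E.scale_add_left)
    show "complete ?V"
      by (rule complete_closed_subset[OF closed_translation_continuous _ complete_UNIV_bcontfun]) simp
  qed (simp_all add: add real assoc norm_pointwise_scale[OF assms])
qed

lemma isometric_representation_on_translate:
  fixes smul :: "'k::real_normed_field \<Rightarrow> 'e::real_normed_vector \<Rightarrow> 'e"
  assumes "banach_space_on smul UNIV"
  shows "isometric_representation_on (pointwise_scale smul)
    (translation_continuous :: ((real \<times> 'w::topological_space) \<Rightarrow>\<^sub>C 'e) set) translate"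
    (is "isometric_representation_on _ ?V _")
proof -
  have "f \<in> translate t ` ?V" if "f \<in> ?V" for t f
  proof
    show "f = translate t (translate (- t) f)" by (simp add: translate_translate)
  qed (rule translate_mem_translation_continuous[OF that])
  moreover have "\<exists>B. \<forall>f\<in>?V. norm (translate t f) \<le> B * norm f" for t
    by (rule exI[of _ 1]) simp
  ultimately show ?thesis
    unfolding isometric_representation_on_def bounded_operator_on_def isometric_on_def
    by (auto simp: translate_translate translate_add translate_pointwise_scale[OF assms]
        translate_mem_translation_continuous)
qed

text \<open>
  Evaluation cannot increase the supremum norm, and the constant function \<open>y\<close> is a preimage of
  \<open>y\<close> with the same norm.
\<close>

lemma surjective_isometry_mod_kernel_evaluation:
  "surjective_isometry_mod_kernel
     (translation_continuous :: ((real \<times> 'w::topological_space) \<Rightarrow>\<^sub>C 'e::real_normed_vector) set)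
     UNIV (\<lambda>f. apply_bcontfun f (0, \<omega>))"
proof -
  let ?V = "translation_continuous :: ((real \<times> 'w) \<Rightarrow>\<^sub>C 'e) set"
  have const: "const_bcontfun y \<in> ?V" for y
  proof -
    have "translate t (const_bcontfun y) = (const_bcontfun y :: (real \<times> 'w) \<Rightarrow>\<^sub>C 'e)" for t
      by (rule bcontfun_eqI) auto
    then show ?thesis by (simp add: translation_continuous_def)
  qed
  have "y \<in> (\<lambda>f. apply_bcontfun f (0, \<omega>)) ` ?V" for y
    by (rule image_eqI[OF _ const[of y]]) simp
  moreover have "(INF f\<in>{f\<in>?V. f (0, \<omega>) = y}. norm f) = norm y" for y
  proof (rule cInf_eq_minimum)
    have "norm (const_bcontfun y :: (real \<times> 'w) \<Rightarrow>\<^sub>C 'e) = norm y"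
      by (rule antisym[OF norm_bound])
        (use norm_bounded[of "const_bcontfun y :: (real \<times> 'w) \<Rightarrow>\<^sub>C 'e"] in auto)
    then show "norm y \<in> norm ` {f\<in>?V. f (0, \<omega>) = y}"
      using const by (intro image_eqI[of _ _ "const_bcontfun y"]) auto
  qed (use norm_bounded in blast)
  ultimately show ?thesis unfolding surjective_isometry_mod_kernel_def by auto
qed

section \<open>Orbit functions and the dilation\<close>

text \<open>
  Truncating the time at \<open>0\<close> extends orbits to negative times by their initial value, which
  preserves both continuity and the bound \<open>\<parallel>x\<parallel>\<close>.
\<close>

definition orbit_function ::
    "('w::topological_space \<Rightarrow> real \<Rightarrow> 'e \<Rightarrow> 'e::real_normed_vector) \<Rightarrow> 'e \<Rightarrow> ((real \<times> 'w) \<Rightarrow>\<^sub>C 'e)"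
  where "orbit_function T x = Bcontfun (\<lambda>(s, \<omega>). T \<omega> (max s 0) x)"

lemma apply_orbit_function:
  assumes T: "\<And>\<omega>. contractive_C0_semigroup smul (T \<omega>)"
    and joint: "continuous_on ({0..} \<times> UNIV) (\<lambda>(t, \<omega>). T \<omega> t x)"
  shows "apply_bcontfun (orbit_function T x) (s, \<omega>) = T \<omega> (max s 0) x"
proof -
  have "continuous_on UNIV (\<lambda>p. (\<lambda>(t, \<omega>). T \<omega> t x) (max (fst p) 0, snd p))"
    by (rule continuous_on_compose2[OF joint]) (auto intro!: continuous_intros)
  then have "(\<lambda>p. T (snd p) (max (fst p) 0) x) \<in> bcontfun"
    using T unfolding contractive_C0_semigroup_def
    by (intro bcontfun_normI[where b = "norm x"]) auto
  then show ?thesis by (simp add: orbit_function_def case_prod_beta' Bcontfun_inverse)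
qed

text \<open>
  By contractivity a time shift moves no orbit more than it moves the orbit's initial value, so
  only continuity at time \<open>0\<close>, uniformly in the index, has to be supplied.
\<close>

lemma orbit_function_mem_translation_continuous:
  fixes T :: "'w::topological_space \<Rightarrow> real \<Rightarrow> 'e \<Rightarrow> 'e::real_normed_vector"
  assumes compact: "compact (UNIV :: 'w set)"
    and T: "\<And>\<omega>. contractive_C0_semigroup smul (T \<omega>)"
    and joint: "continuous_on ({0..} \<times> UNIV) (\<lambda>(t, \<omega>). T \<omega> t x)"
  shows "orbit_function T x \<in> translation_continuous"
proof -
  have "\<exists>d>0. \<forall>t. dist t t\<^sub>0 < d \<longrightarrow>
      dist (translate t (orbit_function T x)) (translate t\<^sub>0 (orbit_function T x)) \<le> e"
    if e: "e > 0" for t\<^sub>0 e :: real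
  proof -
    \<comment> \<open>compactness of the index space makes the continuity at time \<open>0\<close> uniform in the index\<close>
    obtain A where A: "0 \<in> A" "open A"
      "\<forall>h\<in>A \<inter> {0..}. \<forall>\<omega>\<in>UNIV. dist ((\<lambda>(t, \<omega>). T \<omega> t x) (h, \<omega>)) ((\<lambda>(t, \<omega>). T \<omega> t x) (0, \<omega>)) \<le> e"
      by (rule continuous_on_prod_compactE[OF joint compact, of 0 e]) (use e in auto)
    obtain d where d: "d > 0" "ball 0 d \<subseteq> A" using A openE by blast
    have small: "dist (T \<omega> h x) x \<le> e" if "0 \<le> h" "h < d" for h \<omega>
    proof -
      have "h \<in> A" using that d by (auto simp: dist_norm)
      then have "dist (T \<omega> h x) (T \<omega> 0 x) \<le> e" using A(3) that by simp
      moreover have "T \<omega> 0 x = x" using T[of \<omega>] unfolding contractive_C0_semigroup_def by simp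
      ultimately show ?thesis by simp
    qed
    have "dist (translate t (orbit_function T x)) (translate t\<^sub>0 (orbit_function T x)) \<le> e"
      if "dist t t\<^sub>0 < d" for t
    proof (rule dist_bound, clarify)
      fix s \<omega>
      have "\<bar>max (s + t) 0 - max (s + t\<^sub>0) 0\<bar> < d"
        using that by (auto simp: dist_real_def)
      then have "dist (T \<omega> (max (s + t) 0) x) (T \<omega> (max (s + t\<^sub>0) 0) x) \<le> e"
        using contractive_C0_semigroup_dist_le[OF T, of "max (s + t) 0" "max (s + t\<^sub>0) 0" \<omega> x]
          small[of "\<bar>max (s + t) 0 - max (s + t\<^sub>0) 0\<bar>" \<omega>] by auto
      then show "dist (translate t (orbit_function T x) (s, \<omega>))
          (translate t\<^sub>0 (orbit_function T x) (s, \<omega>)) \<le> e"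
        by (simp add: apply_orbit_function[OF T joint])
    qed
    with d(1) show ?thesis by blast
  qed
  then have "\<exists>d>0. \<forall>t. dist t t\<^sub>0 < d \<longrightarrow>
      dist (translate t (orbit_function T x)) (translate t\<^sub>0 (orbit_function T x)) < e"
    if "e > 0" for t\<^sub>0 e :: real
    using that dense[of 0 e] by (meson le_less_trans)
  then show ?thesis
    unfolding translation_continuous_def continuous_on_iff by simp
qed

lemma norm_orbit_function:
  assumes T: "\<And>\<omega>. contractive_C0_semigroup smul (T \<omega>)"
    and joint: "continuous_on ({0..} \<times> UNIV) (\<lambda>(t, \<omega>). T \<omega> t x)"
  shows "norm (orbit_function T x) = norm x"
proof (rule antisym)
  show "norm (orbit_function T x) \<le> norm x"
    using T by (intro norm_bound)
      (auto simp: apply_orbit_function[OF T joint] contractive_C0_semigroup_def)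
  show "norm x \<le> norm (orbit_function T x)"
    using norm_bounded[of "orbit_function T x" "(0, undefined)"] T
    by (auto simp: apply_orbit_function[OF T joint] contractive_C0_semigroup_def)
qed

lemma simultaneous_dilation_translate:
  fixes scaleE :: "'k::real_normed_field \<Rightarrow> 'e::banach \<Rightarrow> 'e"
    and T :: "'w::topological_space \<Rightarrow> real \<Rightarrow> 'e \<Rightarrow> 'e"
  assumes compact: "compact (UNIV :: 'w set)"
    and E: "banach_space_on scaleE (UNIV :: 'e set)"
    and T: "\<And>\<omega>. contractive_C0_semigroup scaleE (T \<omega>)"
    and k: "kSOT_continuous_in_index T"
  shows "simultaneous_dilation scaleE T (pointwise_scale scaleE) translation_continuous
    (orbit_function T) (\<lambda>\<omega> f. apply_bcontfun f (0, \<omega>)) translate"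
proof -
  let ?V = "translation_continuous :: ((real \<times> 'w) \<Rightarrow>\<^sub>C 'e) set"
  have joint: "continuous_on ({0..} \<times> UNIV) (\<lambda>(t, \<omega>). T \<omega> t x)" for x
    using k kSOT_continuous_in_index_iff_jointly_continuous[where T = T, OF T] by blast
  note apply_orbit = apply_orbit_function[where T = T, OF T joint]
  have T_linear: "bounded_operator_on scaleE UNIV scaleE UNIV (T \<omega> t)" if "t \<ge> 0" for \<omega> t
    using T that unfolding contractive_C0_semigroup_def by blast
  have "orbit_function T (x + y) = orbit_function T x + orbit_function T y" for x y
    using T_linear unfolding bounded_operator_on_def
    by (intro bcontfun_eqI) (auto simp: apply_orbit)
  moreover have "orbit_function T (scaleE c x) = pointwise_scale scaleE c (orbit_function T x)" for c x
    using T_linear unfolding bounded_operator_on_def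
    by (intro bcontfun_eqI) (auto simp: apply_orbit apply_pointwise_scale[OF E])
  ultimately have r: "bounded_operator_on scaleE UNIV (pointwise_scale scaleE) ?V (orbit_function T)"
    unfolding bounded_operator_on_def norm_orbit_function[OF T joint]
    by (auto simp: orbit_function_mem_translation_continuous[OF compact T joint] intro: exI[of _ 1])
  have "\<exists>B. \<forall>f\<in>?V. norm (apply_bcontfun f (0, \<omega>)) \<le> B * norm f" for \<omega>
    by (rule exI[of _ 1]) (simp add: norm_bounded)
  then have j: "bounded_operator_on (pointwise_scale scaleE) ?V scaleE UNIV (\<lambda>f. apply_bcontfun f (0, \<omega>))" for \<omega>
    unfolding bounded_operator_on_def by (simp add: apply_pointwise_scale[OF E])
  have j_continuous: "continuous_on UNIV (\<lambda>\<omega>. f (0, \<omega>))" for f :: "(real \<times> 'w) \<Rightarrow>\<^sub>C 'e"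
    by (rule continuous_on_compose2[OF continuous_on_apply_bcontfun[of UNIV f]])
      (auto intro!: continuous_intros)
  show ?thesis
    unfolding simultaneous_dilation_def
    using banach_space_on_translation_continuous[OF E, where 'w = 'w] r j j_continuous
      surjective_isometry_mod_kernel_evaluation isometric_representation_on_translate[OF E]
    by (auto simp: isometric_on_def norm_orbit_function[OF T joint] translation_continuous_def
        apply_orbit)
qed

(* The existential needs some fixed type to carry the large space; the ambient type below is big
   enough for the forward implication, and the second conjunct gives the converse implication for
   carriers in an arbitrary type 'f. *)
theorem proposition3p14:
  fixes scaleE :: "'k::real_normed_field \<Rightarrow> 'e::banach \<Rightarrow> 'e"
    and T :: "'w::topological_space \<Rightarrow> real \<Rightarrow> 'e \<Rightarrow> 'e"
  assumes "compact (UNIV :: 'w set)"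
    and "banach_space_on scaleE (UNIV :: 'e set)"
    and "\<And>\<omega>. contractive_C0_semigroup scaleE (T \<omega>)"
  shows "(kSOT_continuous_in_index T \<longleftrightarrow>
           (\<exists>(V :: ((real \<times> 'w) \<Rightarrow>\<^sub>C 'e) set) scaleV r j U.
              simultaneous_dilation scaleE T scaleV V r j U)) \<and>
         (\<forall>(V :: 'f::real_normed_vector set) scaleV r j U.
              simultaneous_dilation scaleE T scaleV V r j U \<longrightarrow> kSOT_continuous_in_index T)"
proof (intro conjI iffI)
  assume "kSOT_continuous_in_index T"
  from simultaneous_dilation_translate[OF assms this]
  show "\<exists>(V :: ((real \<times> 'w) \<Rightarrow>\<^sub>C 'e) set) scaleV r j U.
      simultaneous_dilation scaleE T scaleV V r j U" by blast
qed (use kSOT_continuous_in_index_if_dilation[where T = T, OF assms(3)] in blast)+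

end
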